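(* Let $k,l\in\mathbb{N}$ and let $a_1,\dots,a_k,b_1,\dots,b_k,c_1,\dots,c_l,d_1,\dots,d_l\in\mathbb{N}^{+}$ be positive integers. Then the generating series of the species $H\left(\frac{a_1}{b_1},\dots,\frac{a_k}{b_k};\frac{c_1}{d_1},\dots,\frac{c_l}{d_l}\right):\mathbb{B}\to gpd$ is the hypergeometric series: $$\left|H\left(\tfrac{a_1}{b_1},\dots,\tfrac{a_k}{b_k};\tfrac{c_1}{d_1},\dots,\tfrac{c_l}{d_l}\right)\right| = h\left(\tfrac{a_1}{b_1},\dots,\tfrac{a_k}{b_k};\tfrac{c_1}{d_1},\dots,\tfrac{c_l}{d_l}\right)$$ as formal power series.
   Context: Groupoids. A groupoid is a category all of whose morphisms are invertible; it is finite if its set of objects and all its hom-sets are finite. $gpd$ is the category of finite groupoids and functors. A finite set is regarded as a groupoid with only identity morphisms; $[n]=\{1,\dots,n\}$ and $[0]=\emptyset$. A finite group $\Gamma$ gives a groupoid $\overline{\Gamma}$ with one object whose set of endomorphisms is $\Gamma$; $\mathbb{Z}_n$ is the cyclic group of order $n$. $\sqcup$ and $\times$ denote disjoint union and Cartesian product of groupoids; empty products are the groupoid $1$ with one object and one morphism. The cardinality of a finite groupoid $G$ is $|G|=\sum_{x\in D(G)}\frac{1}{|G(x,x)|}\in\mathbb{Q}$, where $D(G)$ is the set of isomorphism classes of objects of $G$. Species. $\mathbb{B}$ is the groupoid of finite sets and bijections. A ($\mathbb{B}$-$gpd$) species is a functor $F:\mathbb{B}\to gpd$; its generating series is $|F|=\sum_{n\in\mathbb{N}}|F([n])|\frac{x^n}{n!}$,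 a formal power series with nonnegative rational coefficients. Pochhammer symbols. For numbers $a$ and $n\in\mathbb{N}$, $(a)_n=a(a+1)\cdots(a+n-1)$, with $(a)_0=1$. For finite groupoids $G,K$ and $n\in\mathbb{N}$, $(G)_{n,K}=\prod_{i=0}^{n-1}\bigl(G\sqcup(K\times[i])\bigr)$. Hypergeometric series. For numbers $\alpha_1,\dots,\alpha_k$ and $\beta_1,\dots,\beta_l$ with no $\beta_j$ zero or a negative integer, $$h(\alpha_1,\dots,\alpha_k;\beta_1,\dots,\beta_l)=\sum_{n=0}^{\infty}\frac{(\alpha_1)_n\cdots(\alpha_k)_n}{(\beta_1)_n\cdots(\beta_l)_n}\frac{x^n}{n!}.$$ The species $H$. For positive integers $c,d$ and $n\in\mathbb{N}$ put $\overline{\mathbb{Z}}_{c,n,d}=\prod_{i=0}^{n-1}\overline{\mathbb{Z}}_{c+id}$. For a finite set $x$, $\overline{\mathbb{Z}}_{b}^{x}$ is the product of copies of $\overline{\mathbb{Z}}_b$ indexed by $x$, and $[d]^x$ is the set of maps $x\to[d]$. Then $$H\left(\tfrac{a_1}{b_1},\dots,\tfrac{a_k}{b_k};\tfrac{c_1}{d_1},\dots,\tfrac{c_l}{d_l}\right)(x)=\prod_{i=1}^{k}\Bigl(([a_i])_{|x|,[b_i]}\times\overline{\mathbb{Z}}_{b_i}^{x}\Bigr)\times\prod_{j=1}^{l}\Bigl([d_j]^{x}\times\overline{\mathbb{Z}}_{c_j,|x|,d_j}\Bigr).$$ A bijection $x\to y$ acts by relabelling the index set in the factors $\overline{\mathbb{Z}}_{b_i}^{x}$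 and $[d_j]^x$, and by the identity on the factors depending only on $|x|$. *)

theory Defs
  imports
    "HOL-Algebra.Elementary_Groups"
    "HOL-Computational_Algebra.Formal_Power_Series"
begin

section \<open>Categories, groupoids and functors\<close>

text \<open>
  \<open>cmp C g f\<close> is the composite "\<open>f\<close>, then \<open>g\<close>"; its value matters only if \<open>trg C f = src C g\<close>.
\<close>

record ('o, 'm) cat =
  obj :: "'o set"
  arr :: "'m set"
  src :: "'m \<Rightarrow> 'o"
  trg :: "'m \<Rightarrow> 'o"
  idn :: "'o \<Rightarrow> 'm"
  cmp :: "'m \<Rightarrow> 'm \<Rightarrow> 'm"

definition homset :: "('o, 'm) cat \<Rightarrow> 'o \<Rightarrow> 'o \<Rightarrow> 'm set" where
  "homset C x y = {f \<in> arr C. src C f = x \<and> trg C f = y}"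

locale category =
  fixes C :: "('o, 'm) cat"
  assumes src_in_obj: "f \<in> arr C \<Longrightarrow> src C f \<in> obj C"
    and trg_in_obj: "f \<in> arr C \<Longrightarrow> trg C f \<in> obj C"
    and idn_in_hom: "x \<in> obj C \<Longrightarrow> idn C x \<in> homset C x x"
    and cmp_in_hom: "f \<in> homset C x y \<Longrightarrow> g \<in> homset C y z \<Longrightarrow> cmp C g f \<in> homset C x z"
    and cmp_idn_right: "f \<in> homset C x y \<Longrightarrow> cmp C f (idn C x) = f"
    and cmp_idn_left: "f \<in> homset C x y \<Longrightarrow> cmp C (idn C y) f = f"
    and cmp_assoc: "f \<in> homset C w x \<Longrightarrow> g \<in> homset C x y \<Longrightarrow> h \<in> homset C y z
      \<Longrightarrow> cmp C h (cmp C g f) = cmp C (cmp C h g) f"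

definition isomorphism :: "('o, 'm) cat \<Rightarrow> 'm \<Rightarrow> bool" where
  "isomorphism C f \<longleftrightarrow> f \<in> arr C \<and>
     (\<exists>g \<in> homset C (trg C f) (src C f).
        cmp C g f = idn C (src C f) \<and> cmp C f g = idn C (trg C f))"

locale groupoid = category +
  assumes arr_isomorphism: "f \<in> arr C \<Longrightarrow> isomorphism C f"

locale finite_groupoid = groupoid +
  assumes finite_obj: "finite (obj C)"
    and finite_homset: "x \<in> obj C \<Longrightarrow> y \<in> obj C \<Longrightarrow> finite (homset C x y)"

record ('o, 'm, 'p, 'q) functr =
  fobj :: "'o \<Rightarrow> 'p"
  farr :: "'m \<Rightarrow> 'q"

locale cat_functor = S: category C + T: category D
  for C :: "('o, 'm) cat" and D :: "('p, 'q) cat" +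
  fixes F :: "('o, 'm, 'p, 'q) functr"
  assumes fobj_in_obj: "x \<in> obj C \<Longrightarrow> fobj F x \<in> obj D"
    and farr_in_hom: "f \<in> homset C x y \<Longrightarrow> farr F f \<in> homset D (fobj F x) (fobj F y)"
    and farr_idn: "x \<in> obj C \<Longrightarrow> farr F (idn C x) = idn D (fobj F x)"
    and farr_cmp: "f \<in> homset C x y \<Longrightarrow> g \<in> homset C y z
      \<Longrightarrow> farr F (cmp C g f) = cmp D (farr F g) (farr F f)"


section \<open>Constructions on groupoids\<close>

definition discrete_cat :: "'a set \<Rightarrow> ('a, 'a) cat" where
  "discrete_cat S =
    \<lparr>obj = S, arr = S, src = (\<lambda>x. x), trg = (\<lambda>x. x), idn = (\<lambda>x. x), cmp = (\<lambda>g f. f)\<rparr>"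

definition group_cat :: "'a monoid \<Rightarrow> (unit, 'a) cat" where
  "group_cat G =
    \<lparr>obj = {()}, arr = carrier G, src = (\<lambda>_. ()), trg = (\<lambda>_. ()),
     idn = (\<lambda>_. one G), cmp = (\<lambda>g f. monoid.mult G g f)\<rparr>"

definition sum_cat :: "('o, 'm) cat \<Rightarrow> ('p, 'q) cat \<Rightarrow> ('o + 'p, 'm + 'q) cat" where
  "sum_cat C D =
    \<lparr>obj = obj C <+> obj D,
     arr = arr C <+> arr D,
     src = map_sum (src C) (src D),
     trg = map_sum (trg C) (trg D),
     idn = map_sum (idn C) (idn D),
     cmp = (\<lambda>g f. case (g, f) of
              (Inl g', Inl f') \<Rightarrow> Inl (cmp C g' f')
            | (Inr g', Inr f') \<Rightarrow> Inr (cmp D g' f')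
            | _ \<Rightarrow> undefined)\<rparr>"

definition prod_cat :: "('o, 'm) cat \<Rightarrow> ('p, 'q) cat \<Rightarrow> ('o \<times> 'p, 'm \<times> 'q) cat" where
  "prod_cat C D =
    \<lparr>obj = obj C \<times> obj D,
     arr = arr C \<times> arr D,
     src = map_prod (src C) (src D),
     trg = map_prod (trg C) (trg D),
     idn = map_prod (idn C) (idn D),
     cmp = (\<lambda>g f. (cmp C (fst g) (fst f), cmp D (snd g) (snd f)))\<rparr>"

definition Prod_cat :: "'i set \<Rightarrow> ('i \<Rightarrow> ('o, 'm) cat) \<Rightarrow> ('i \<Rightarrow> 'o, 'i \<Rightarrow> 'm) cat" where
  "Prod_cat I C =
    \<lparr>obj = (\<Pi>\<^sub>E i\<in>I. obj (C i)),
     arr = (\<Pi>\<^sub>E i\<in>I. arr (C i)),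
     src = (\<lambda>f. \<lambda>i\<in>I. src (C i) (f i)),
     trg = (\<lambda>f. \<lambda>i\<in>I. trg (C i) (f i)),
     idn = (\<lambda>x. \<lambda>i\<in>I. idn (C i) (x i)),
     cmp = (\<lambda>g f. \<lambda>i\<in>I. cmp (C i) (g i) (f i))\<rparr>"

definition pochhammer_cat ::
  "('o, 'm) cat \<Rightarrow> ('p, 'q) cat \<Rightarrow> nat \<Rightarrow> (nat \<Rightarrow> 'o + 'p \<times> nat, nat \<Rightarrow> 'm + 'q \<times> nat) cat" where
  "pochhammer_cat G K n =
     Prod_cat {0..<n} (\<lambda>i. sum_cat G (prod_cat K (discrete_cat {1..i})))"

definition cyclic_cat :: "nat \<Rightarrow> (unit, int) cat" where
  "cyclic_cat n = group_cat (integer_mod_group n)"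


section \<open>Cardinality\<close>

definition iso_classes :: "('o, 'm) cat \<Rightarrow> 'o set set" where
  "iso_classes G =
     obj G // {(x, y). x \<in> obj G \<and> y \<in> obj G \<and> (\<exists>f \<in> homset G x y. isomorphism G f)}"

definition gpd_card :: "('o, 'm) cat \<Rightarrow> rat" where
  "gpd_card G =
     (\<Sum>X \<in> iso_classes G. let x = (SOME x. x \<in> X) in 1 / of_nat (card (homset G x x)))"


section \<open>The categories of finite sets and bijections, and of finite groupoids\<close>

text \<open>
  In both categories an arrow is a triple (source, map, target). The maps are
  extensional (\<^term>\<open>undefined\<close> outside their domain), so that equality of arrows is
  equality of maps on the domain.
\<close>

definition finbij :: "('x set, 'x set \<times> ('x \<Rightarrow> 'x) \<times> 'x set) cat" where
  "finbij =
    \<lparr>obj = {x. finite x},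
     arr = {(x, f, y). finite x \<and> finite y \<and> f \<in> extensional x \<and> bij_betw f x y},
     src = (\<lambda>(x, f, y). x),
     trg = (\<lambda>(x, f, y). y),
     idn = (\<lambda>x. (x, \<lambda>a\<in>x. a, x)),
     cmp = (\<lambda>(y, g, z) (x, f, y'). (x, compose x g f, z))\<rparr>"

type_synonym ('o, 'm) gpd_arr = "('o, 'm) cat \<times> ('o, 'm, 'o, 'm) functr \<times> ('o, 'm) cat"

definition gpd :: "(('o, 'm) cat, ('o, 'm) gpd_arr) cat" where
  "gpd =
    \<lparr>obj = {G. finite_groupoid G},
     arr = {(G, F, K). finite_groupoid G \<and> finite_groupoid K \<and> cat_functor G K F \<and>
              fobj F \<in> extensional (obj G) \<and> farr F \<in> extensional (arr G)},
     src = (\<lambda>(G, F, K). G),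
     trg = (\<lambda>(G, F, K). K),
     idn = (\<lambda>G. (G, \<lparr>fobj = \<lambda>x\<in>obj G. x, farr = \<lambda>f\<in>arr G. f\<rparr>, G)),
     cmp = (\<lambda>(K, E, L) (G, F, K').
              (G, \<lparr>fobj = compose (obj G) (fobj E) (fobj F),
                   farr = compose (arr G) (farr E) (farr F)\<rparr>, L))\<rparr>"


section \<open>Species\<close>

type_synonym ('x, 'o, 'm) species =
  "('x set, 'x set \<times> ('x \<Rightarrow> 'x) \<times> 'x set, ('o, 'm) cat, ('o, 'm) gpd_arr) functr"

abbreviation species :: "('x, 'o, 'm) species \<Rightarrow> bool" where
  "species F \<equiv> cat_functor finbij gpd F"

definition generating_series :: "(nat, 'o, 'm) species \<Rightarrow> rat fps" where
  "generating_series F = Abs_fps (\<lambda>n. gpd_card (fobj F {1..n}) / fact n)"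


section \<open>The hypergeometric species\<close>

type_synonym 'x H_obj =
  "(nat \<Rightarrow> (nat \<Rightarrow> nat + nat \<times> nat) \<times> ('x \<Rightarrow> unit)) \<times> (nat \<Rightarrow> ('x \<Rightarrow> nat) \<times> (nat \<Rightarrow> unit))"

type_synonym 'x H_arr =
  "(nat \<Rightarrow> (nat \<Rightarrow> nat + nat \<times> nat) \<times> ('x \<Rightarrow> int)) \<times> (nat \<Rightarrow> ('x \<Rightarrow> nat) \<times> (nat \<Rightarrow> int))"

definition H_gpd ::
  "nat \<Rightarrow> (nat \<Rightarrow> nat) \<Rightarrow> (nat \<Rightarrow> nat) \<Rightarrow> nat \<Rightarrow> (nat \<Rightarrow> nat) \<Rightarrow> (nat \<Rightarrow> nat)
   \<Rightarrow> 'x set \<Rightarrow> ('x H_obj, 'x H_arr) cat" where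
  "H_gpd k a b l c d x =
     prod_cat
       (Prod_cat {1..k} (\<lambda>i.
          prod_cat (pochhammer_cat (discrete_cat {1..a i}) (discrete_cat {1..b i}) (card x))
                   (Prod_cat x (\<lambda>_. cyclic_cat (b i)))))
       (Prod_cat {1..l} (\<lambda>j.
          prod_cat (discrete_cat (x \<rightarrow>\<^sub>E {1..d j}))
                   (Prod_cat {0..<card x} (\<lambda>i. cyclic_cat (c j + i * d j)))))"

definition relabel :: "'x set \<Rightarrow> ('x \<Rightarrow> 'x) \<Rightarrow> 'x set \<Rightarrow> ('x \<Rightarrow> 'v) \<Rightarrow> ('x \<Rightarrow> 'v)" where
  "relabel x f y p = (\<lambda>t\<in>y. p (inv_into x f t))"

text \<open>
  One polymorphic map serves both for the objects and for the arrows of \<^const>\<open>H_gpd\<close>.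
\<close>

definition H_relabel ::
  "nat \<Rightarrow> nat \<Rightarrow> 'x set \<Rightarrow> ('x \<Rightarrow> 'x) \<Rightarrow> 'x set
   \<Rightarrow> (nat \<Rightarrow> 'p \<times> ('x \<Rightarrow> 'q)) \<times> (nat \<Rightarrow> ('x \<Rightarrow> 'r) \<times> 's)
   \<Rightarrow> (nat \<Rightarrow> 'p \<times> ('x \<Rightarrow> 'q)) \<times> (nat \<Rightarrow> ('x \<Rightarrow> 'r) \<times> 's)" where
  "H_relabel k l x f y = (\<lambda>(u, v).
     (\<lambda>i\<in>{1..k}. map_prod id (relabel x f y) (u i),
      \<lambda>j\<in>{1..l}. map_prod (relabel x f y) id (v j)))"

definition H_species ::
  "nat \<Rightarrow> (nat \<Rightarrow> nat) \<Rightarrow> (nat \<Rightarrow> nat) \<Rightarrow> nat \<Rightarrow> (nat \<Rightarrow> nat) \<Rightarrow> (nat \<Rightarrow> nat)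
   \<Rightarrow> ('x, 'x H_obj, 'x H_arr) species" where
  "H_species k a b l c d =
    \<lparr>fobj = H_gpd k a b l c d,
     farr = (\<lambda>(x, f, y).
       (H_gpd k a b l c d x,
        \<lparr>fobj = restrict (H_relabel k l x f y) (obj (H_gpd k a b l c d x)),
         farr = restrict (H_relabel k l x f y) (arr (H_gpd k a b l c d x))\<rparr>,
        H_gpd k a b l c d y))\<rparr>"

definition hypergeometric_series :: "'a::field_char_0 list \<Rightarrow> 'a list \<Rightarrow> 'a fps" where
  "hypergeometric_series \<alpha> \<beta> = fps_hypergeo \<alpha> \<beta> 1"

end

theory Submission
  imports Defs
begin

text \<open>
  The cardinality of a finite groupoid is the sum of \<open>1 / n\<^sub>x\<close> over all objects \<open>x\<close>, where \<open>n\<^sub>x\<close> is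
  the number of arrows out of \<open>x\<close>; hence it is additive on disjoint unions and multiplicative on
  products. The groupoid of the species at \<open>[n]\<close> has factors of cardinality
  \<open>\<Prod>\<^bsub>m<n\<^esub> (a + m b) / b\<^sup>n = (a/b)\<^sub>n\<close> and \<open>d\<^sup>n / \<Prod>\<^bsub>m<n\<^esub> (c + m d) = 1 / (c/d)\<^sub>n\<close>.
  Functoriality is checked factor by factor.
\<close>

section \<open>Criteria for groupoids and finite groupoids\<close>

lemma groupoidI:
  assumes "category C"
    and inverse: "\<And>f x y. f \<in> homset C x y
      \<Longrightarrow> \<exists>g \<in> homset C y x. cmp C g f = idn C x \<and> cmp C f g = idn C y"
  shows "groupoid C"
proof -
  interpret category C by fact
  show ?thesis
  proof
    fix f assume "f \<in> arr C"
    then show "isomorphism C f"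
      using inverse[of f "src C f" "trg C f"] by (auto simp: isomorphism_def homset_def)
  qed
qed

lemma (in groupoid) inverse_arrow:
  assumes "f \<in> homset C x y"
  obtains g where "g \<in> homset C y x" "cmp C g f = idn C x" "cmp C f g = idn C y"
  using assms arr_isomorphism[of f] by (auto simp: isomorphism_def homset_def)

lemma (in category) homset_objD:
  assumes "f \<in> homset C x y"
  shows "x \<in> obj C" "y \<in> obj C"
  using assms src_in_obj trg_in_obj by (auto simp: homset_def)

text \<open>The constructions below have explicit sums or products as their sets of all arrows, so
  finiteness is easier to check on \<open>arr C\<close> than hom-set by hom-set. The converse
  \<open>finite_arr\<close> supplies the same form for the factors.\<close>

lemma finite_groupoidI:
  assumes "groupoid C" "finite (obj C)" "finite (arr C)"
  shows "finite_groupoid C"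
proof -
  interpret groupoid C by fact
  show ?thesis
    by standard (use assms in \<open>auto simp: homset_def\<close>)
qed

lemma (in finite_groupoid) finite_arr: "finite (arr C)"
proof -
  have "arr C \<subseteq> (\<Union>x\<in>obj C. \<Union>y\<in>obj C. homset C x y)"
    using src_in_obj trg_in_obj by (auto simp: homset_def)
  then show ?thesis
    using finite_obj finite_homset by (meson finite_UN_I finite_subset)
qed


section \<open>Groupoid constructions\<close>

lemma groupoid_discrete_cat: "groupoid (discrete_cat S)"
  by unfold_locales (auto simp: discrete_cat_def homset_def isomorphism_def)

lemma finite_groupoid_discrete_cat: "finite S \<Longrightarrow> finite_groupoid (discrete_cat S)"
  by (rule finite_groupoidI[OF groupoid_discrete_cat]) (auto simp: discrete_cat_def)

lemma groupoid_group_cat: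
  assumes "group G"
  shows "groupoid (group_cat G)"
proof -
  interpret group G by fact
  have "category (group_cat G)"
    by unfold_locales (auto simp: group_cat_def homset_def m_assoc)
  then show ?thesis
    by (rule groupoidI) (auto simp: group_cat_def homset_def intro!: bexI[of _ "inv\<^bsub>G\<^esub> _"])
qed

lemma finite_groupoid_cyclic_cat: "0 < n \<Longrightarrow> finite_groupoid (cyclic_cat n)"
  unfolding cyclic_cat_def
  by (rule finite_groupoidI[OF groupoid_group_cat])
    (auto simp: group_cat_def carrier_integer_mod_group)

text \<open>The mixed hom-sets are empty, so the \<open>undefined\<close> clause of composition is
  never reached by composable arrows, and a case split on the end objects reduces every law to a
  single summand.\<close>

lemma homset_sum_cat:
  "homset (sum_cat C D) (Inl x) (Inl x') = Inl ` homset C x x'"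
  "homset (sum_cat C D) (Inr y) (Inr y') = Inr ` homset D y y'"
  "homset (sum_cat C D) (Inl x) (Inr y) = {}"
  "homset (sum_cat C D) (Inr y) (Inl x) = {}"
  by (auto simp: homset_def sum_cat_def)

lemma category_sum_cat:
  assumes "category C" "category D"
  shows "category (sum_cat C D)"
proof -
  interpret C: category C by fact
  interpret D: category D by fact
  have cmp: "cmp (sum_cat C D) (Inl g) (Inl f) = Inl (cmp C g f)"
    "cmp (sum_cat C D) (Inr g') (Inr f') = Inr (cmp D g' f')" for g f g' f'
    by (auto simp: sum_cat_def)
  have idn: "idn (sum_cat C D) (Inl x) = Inl (idn C x)"
    "idn (sum_cat C D) (Inr y) = Inr (idn D y)" for x y
    by (auto simp: sum_cat_def)
  have obj: "obj (sum_cat C D) = obj C <+> obj D"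
    by (simp add: sum_cat_def)
  show ?thesis
  proof
    show "src (sum_cat C D) f \<in> obj (sum_cat C D)" "trg (sum_cat C D) f \<in> obj (sum_cat C D)"
      if "f \<in> arr (sum_cat C D)" for f
      using that C.src_in_obj C.trg_in_obj D.src_in_obj D.trg_in_obj
      by (auto simp: sum_cat_def)
    show "idn (sum_cat C D) x \<in> homset (sum_cat C D) x x" if "x \<in> obj (sum_cat C D)" for x
      using that C.idn_in_hom D.idn_in_hom
      by (cases x) (auto simp: idn homset_sum_cat obj)
    fix f g h w x y z
    show "cmp (sum_cat C D) g f \<in> homset (sum_cat C D) x z"
      if "f \<in> homset (sum_cat C D) x y" "g \<in> homset (sum_cat C D) y z"
      using that C.cmp_in_hom D.cmp_in_hom
      by (cases x; cases y; cases z) (auto simp: homset_sum_cat cmp)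
    show "cmp (sum_cat C D) f (idn (sum_cat C D) x) = f"
      if "f \<in> homset (sum_cat C D) x y"
      using that C.cmp_idn_right D.cmp_idn_right
      by (cases x; cases y) (auto simp: homset_sum_cat cmp idn)
    show "cmp (sum_cat C D) (idn (sum_cat C D) y) f = f"
      if "f \<in> homset (sum_cat C D) x y"
      using that C.cmp_idn_left D.cmp_idn_left
      by (cases x; cases y) (auto simp: homset_sum_cat cmp idn)
    show "cmp (sum_cat C D) h (cmp (sum_cat C D) g f) = cmp (sum_cat C D) (cmp (sum_cat C D) h g) f"
      if "f \<in> homset (sum_cat C D) w x" "g \<in> homset (sum_cat C D) x y" "h \<in> homset (sum_cat C D) y z"
      using that C.cmp_assoc D.cmp_assoc
      by (cases w; cases x; cases y; cases z) (auto simp: homset_sum_cat cmp)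
  qed
qed

lemma groupoid_sum_cat:
  assumes "groupoid C" "groupoid D"
  shows "groupoid (sum_cat C D)"
proof -
  interpret C: groupoid C by fact
  interpret D: groupoid D by fact
  show ?thesis
  proof (rule groupoidI[OF category_sum_cat[OF C.category_axioms D.category_axioms]])
    fix f x y assume f: "f \<in> homset (sum_cat C D) x y"
    show "\<exists>g\<in>homset (sum_cat C D) y x.
        cmp (sum_cat C D) g f = idn (sum_cat C D) x \<and> cmp (sum_cat C D) f g = idn (sum_cat C D) y"
    proof (cases x; cases y)
      fix x' y' assume xy: "x = Inl x'" "y = Inl y'"
      with f obtain f' where f': "f = Inl f'" "f' \<in> homset C x' y'"
        by (auto simp: homset_sum_cat)
      from C.inverse_arrow[OF f'(2)] obtain g where
        "g \<in> homset C y' x'" "cmp C g f' = idn C x'" "cmp C f' g = idn C y'" .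
      then show ?thesis
        by (intro bexI[of _ "Inl g"]) (auto simp: xy f' homset_sum_cat(1), auto simp: sum_cat_def)
    next
      fix x' y' assume xy: "x = Inr x'" "y = Inr y'"
      with f obtain f' where f': "f = Inr f'" "f' \<in> homset D x' y'"
        by (auto simp: homset_sum_cat)
      from D.inverse_arrow[OF f'(2)] obtain g where
        "g \<in> homset D y' x'" "cmp D g f' = idn D x'" "cmp D f' g = idn D y'" .
      then show ?thesis
        by (intro bexI[of _ "Inr g"]) (auto simp: xy f' homset_sum_cat(2), auto simp: sum_cat_def)
    qed (use f in \<open>auto simp: homset_sum_cat\<close>)
  qed
qed

lemma finite_groupoid_sum_cat:
  assumes "finite_groupoid C" "finite_groupoid D"
  shows "finite_groupoid (sum_cat C D)"
proof -
  interpret C: finite_groupoid C by fact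
  interpret D: finite_groupoid D by fact
  show ?thesis
    by (rule finite_groupoidI[OF groupoid_sum_cat[OF C.groupoid_axioms D.groupoid_axioms]])
      (auto simp: sum_cat_def C.finite_obj D.finite_obj C.finite_arr D.finite_arr)
qed

section \<open>Products of two groupoids and of indexed families\<close>

lemma homset_prod_cat:
  "homset (prod_cat C D) x y = homset C (fst x) (fst y) \<times> homset D (snd x) (snd y)"
  by (auto simp: homset_def prod_cat_def)

lemma category_prod_cat:
  assumes "category C" "category D"
  shows "category (prod_cat C D)"
proof -
  interpret C: category C by fact
  interpret D: category D by fact
  show ?thesis
    by (unfold_locales, unfold homset_prod_cat)
      (auto simp: prod_cat_def C.src_in_obj C.trg_in_obj D.src_in_obj D.trg_in_obj
      C.idn_in_hom D.idn_in_hom C.cmp_idn_left C.cmp_idn_right D.cmp_idn_left D.cmp_idn_right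
      intro: C.cmp_in_hom D.cmp_in_hom C.cmp_assoc D.cmp_assoc)
qed

lemma groupoid_prod_cat:
  assumes "groupoid C" "groupoid D"
  shows "groupoid (prod_cat C D)"
proof -
  interpret C: groupoid C by fact
  interpret D: groupoid D by fact
  show ?thesis
  proof (rule groupoidI[OF category_prod_cat[OF C.category_axioms D.category_axioms]])
    fix f x y assume f: "f \<in> homset (prod_cat C D) x y"
    then obtain f1 f2 where f12: "f = (f1, f2)" "f1 \<in> homset C (fst x) (fst y)"
        "f2 \<in> homset D (snd x) (snd y)"
      by (auto simp: homset_prod_cat)
    from C.inverse_arrow[OF f12(2)] obtain g1 where "g1 \<in> homset C (fst y) (fst x)"
      "cmp C g1 f1 = idn C (fst x)" "cmp C f1 g1 = idn C (fst y)" .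
    moreover from D.inverse_arrow[OF f12(3)] obtain g2 where "g2 \<in> homset D (snd y) (snd x)"
      "cmp D g2 f2 = idn D (snd x)" "cmp D f2 g2 = idn D (snd y)" .
    ultimately show "\<exists>g\<in>homset (prod_cat C D) y x.
        cmp (prod_cat C D) g f = idn (prod_cat C D) x \<and> cmp (prod_cat C D) f g = idn (prod_cat C D) y"
      unfolding homset_prod_cat
      by (intro bexI[of _ "(g1, g2)"]) (auto simp: f12(1) prod_cat_def map_prod_def split: prod.split)
  qed
qed

lemma finite_groupoid_prod_cat:
  assumes "finite_groupoid C" "finite_groupoid D"
  shows "finite_groupoid (prod_cat C D)"
proof -
  interpret C: finite_groupoid C by fact
  interpret D: finite_groupoid D by fact
  show ?thesis
    by (rule finite_groupoidI[OF groupoid_prod_cat[OF C.groupoid_axioms D.groupoid_axioms]])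
      (auto simp: prod_cat_def C.finite_obj D.finite_obj C.finite_arr D.finite_arr)
qed

text \<open>Sources and targets in \<open>Prod_cat\<close> are functions restricted to
  \<open>I\<close>. Hence a hom-set between non-extensional \<open>x\<close> and \<open>y\<close> is
  empty, even when every component hom-set is inhabited.\<close>

lemma homset_Prod_cat:
  "f \<in> homset (Prod_cat I C) x y \<longleftrightarrow>
     f \<in> (\<Pi>\<^sub>E i\<in>I. homset (C i) (x i) (y i)) \<and> x \<in> extensional I \<and> y \<in> extensional I"
  by (auto simp: homset_def Prod_cat_def PiE_def Pi_def extensional_def restrict_def fun_eq_iff)

lemma category_Prod_cat:
  assumes "\<And>i. i \<in> I \<Longrightarrow> category (C i)"
  shows "category (Prod_cat I C)"
  by (unfold_locales, unfold homset_Prod_cat)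
    (auto simp: Prod_cat_def PiE_iff extensional_def fun_eq_iff
      category.cmp_idn_left[OF assms] category.cmp_idn_right[OF assms]
      intro: category.src_in_obj[OF assms] category.trg_in_obj[OF assms]
      category.idn_in_hom[OF assms]
      category.cmp_in_hom[OF assms] category.cmp_assoc[OF assms])

lemma groupoid_Prod_cat:
  assumes "\<And>i. i \<in> I \<Longrightarrow> groupoid (C i)"
  shows "groupoid (Prod_cat I C)"
proof (rule groupoidI)
  show "category (Prod_cat I C)"
    using assms by (intro category_Prod_cat) (auto simp: groupoid_def)
  fix f x y assume f: "f \<in> homset (Prod_cat I C) x y"
  have "\<forall>i\<in>I. \<exists>g. g \<in> homset (C i) (y i) (x i) \<and> cmp (C i) g (f i) = idn (C i) (x i)
      \<and> cmp (C i) (f i) g = idn (C i) (y i)"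
  proof
    fix i assume i: "i \<in> I"
    then have "f i \<in> homset (C i) (x i) (y i)"
      using f by (auto simp: homset_Prod_cat)
    from groupoid.inverse_arrow[OF assms[OF i] this]
    show "\<exists>g. g \<in> homset (C i) (y i) (x i) \<and> cmp (C i) g (f i) = idn (C i) (x i)
      \<and> cmp (C i) (f i) g = idn (C i) (y i)" by metis
  qed
  \<comment> \<open>Inverses are chosen one component at a time. The chosen function is arbitrary
    off \<open>I\<close>, so the witness below is its restriction.\<close>
  then obtain g where "\<forall>i\<in>I. g i \<in> homset (C i) (y i) (x i) \<and> cmp (C i) (g i) (f i) = idn (C i) (x i)
      \<and> cmp (C i) (f i) (g i) = idn (C i) (y i)"
    by metis
  then show "\<exists>g\<in>homset (Prod_cat I C) y x.
      cmp (Prod_cat I C) g f = idn (Prod_cat I C) x \<and> cmp (Prod_cat I C) f g = idn (Prod_cat I C) y"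
    using f by (intro bexI[of _ "restrict g I"]) (auto simp: homset_Prod_cat, auto simp: Prod_cat_def)
qed

lemma finite_groupoid_Prod_cat:
  assumes "finite I" "\<And>i. i \<in> I \<Longrightarrow> finite_groupoid (C i)"
  shows "finite_groupoid (Prod_cat I C)"
proof (rule finite_groupoidI)
  show "groupoid (Prod_cat I C)"
    using assms(2) by (intro groupoid_Prod_cat) (auto simp: finite_groupoid_def)
  show "finite (obj (Prod_cat I C))" "finite (arr (Prod_cat I C))"
    using assms finite_groupoid.finite_obj finite_groupoid.finite_arr
    by (auto simp: Prod_cat_def intro!: finite_PiE)
qed


section \<open>Cardinality of groupoids\<close>

context category
begin

text \<open>Composing with \<open>f\<close> after an arrow is undone by composing with the inverse
  of \<open>f\<close>.\<close>

lemma card_homset_post: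
  assumes "isomorphism C f" "f \<in> homset C y z"
  shows "card (homset C x y) = card (homset C x z)"
proof -
  obtain g where g: "g \<in> homset C z y" "cmp C g f = idn C y" "cmp C f g = idn C z"
    using assms by (auto simp: isomorphism_def homset_def)
  have "bij_betw (cmp C f) (homset C x y) (homset C x z)"
    by (rule bij_betw_byWitness[where f' = "cmp C g"])
      (use assms(2) g in \<open>auto simp: cmp_assoc cmp_idn_left intro: cmp_in_hom\<close>)
  then show ?thesis
    by (rule bij_betw_same_card)
qed

lemma card_homset_pre:
  assumes "isomorphism C f" "f \<in> homset C x y"
  shows "card (homset C y z) = card (homset C x z)"
proof -
  obtain g where g: "g \<in> homset C y x" "cmp C g f = idn C x" "cmp C f g = idn C y"
    using assms by (auto simp: isomorphism_def homset_def)
  have "bij_betw (\<lambda>h. cmp C h f) (homset C y z) (homset C x z)"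
    by (rule bij_betw_byWitness[where f' = "\<lambda>h. cmp C h g"])
      (use assms(2) g in \<open>auto simp flip: cmp_assoc simp: cmp_idn_right intro: cmp_in_hom\<close>)
  then show ?thesis
    by (rule bij_betw_same_card)
qed

end

definition star :: "('o, 'm) cat \<Rightarrow> 'o \<Rightarrow> 'm set" where
  "star C x = {f \<in> arr C. src C f = x}"

text \<open>
  Each isomorphism class \<open>X\<close> contributes \<open>\<bar>X\<bar>\<close> equal summands \<open>1 / (\<bar>X\<bar> \<bar>G(x, x)\<bar>)\<close>. In this
  form the sum over isomorphism classes becomes a sum over objects, and both the objects and the
  stars of a product are products.
\<close>

lemma (in finite_groupoid) gpd_card_eq_sum_star:
  "gpd_card C = (\<Sum>x\<in>obj C. 1 / of_nat (card (star C x)))"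
proof -
  define R where "R = {(x, y). x \<in> obj C \<and> y \<in> obj C \<and> (\<exists>f \<in> homset C x y. isomorphism C f)}"
  \<comment> \<open>Every arrow is invertible, so being isomorphic just means that the hom-set is
    inhabited.\<close>
  have R_iff: "(x, y) \<in> R \<longleftrightarrow> homset C x y \<noteq> {}" for x y
    using arr_isomorphism homset_objD by (auto simp: R_def homset_def)
  have R: "equiv (obj C) R"
  proof (rule equivI)
    show "R \<subseteq> obj C \<times> obj C" by (auto simp: R_def)
    show "refl_on (obj C) R"
      using idn_in_hom by (auto simp: refl_on_def R_iff)
    show "sym R"
      using inverse_arrow by (auto simp: sym_def R_iff) blast
    show "trans R"
      using cmp_in_hom by (auto simp: trans_def R_iff) blast
  qed
  have class_sum: "(let x = SOME x. x \<in> X in 1 / of_nat (card (homset C x x)) :: rat) =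
      (\<Sum>x\<in>X. 1 / of_nat (card (star C x)))" if X: "X \<in> obj C // R" for X
  proof -
    \<comment> \<open>This is the representative that \<open>gpd_card\<close> picks in the class
      \<open>X\<close>.\<close>
    define y where "y = (SOME x. x \<in> X)"
    have "y \<in> X"
      unfolding y_def using in_quotient_imp_non_empty[OF R X] by (simp add: some_in_eq)
    from X obtain z where "X = R `` {z}"
      by (rule quotientE)
    with \<open>y \<in> X\<close> have Xy: "X = R `` {y}"
      using equiv_class_eq[OF R, of z y] by simp
    have fin: "finite X"
      using finite_obj X R by (meson finite_subset in_quotient_imp_subset)
    \<comment> \<open>The arrows out of \<open>x\<close> are partitioned by their target. The
      targets run exactly through \<open>X\<close>, and each part has the size of the vertex group
      at \<open>y\<close>.\<close>
    have "card (star C x) = card X * card (homset C y y)" if "x \<in> X" for x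
    proof -
      have "homset C y x \<noteq> {}"
        using that by (simp add: Xy R_iff)
      then obtain f where f: "f \<in> homset C y x" by auto
      have fi: "isomorphism C f"
        using f by (auto simp: homset_def arr_isomorphism)
      have xz: "z \<in> X \<longleftrightarrow> homset C x z \<noteq> {}" for z
        using R_iff that R by (metis Image_singleton_iff Xy equiv_class_eq_iff)
      have "card (homset C x z) = card (homset C y y)" if "z \<in> X" for z
      proof -
        have "homset C y z \<noteq> {}"
          using that by (simp add: Xy R_iff)
        then obtain g where g: "g \<in> homset C y z" by auto
        then have "isomorphism C g"
          by (auto simp: homset_def arr_isomorphism)
        \<comment> \<open>Precomposing with \<open>f\<close> passes from arrows out of
          \<open>x\<close> to arrows out of \<open>y\<close>; composing with \<open>g\<close> moves
          the target from \<open>y\<close> to \<open>z\<close>.\<close>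
        with g fi f show ?thesis
          by (metis card_homset_post card_homset_pre)
      qed
      moreover have "star C x = (\<Union>z\<in>X. homset C x z)"
        using xz trg_in_obj by (auto simp: star_def homset_def)
      moreover have "finite (homset C x z)" if "z \<in> X" for z
        using that \<open>x \<in> X\<close> finite_homset in_quotient_imp_subset[OF R X] by auto
      moreover have "homset C x z \<inter> homset C x z' = {}" if "z \<noteq> z'" for z z'
        using that by (auto simp: homset_def)
      ultimately show ?thesis
        using fin by (simp add: card_UN_disjoint)
    qed
    \<comment> \<open>The \<open>card X\<close> equal summands cancel the factor
      \<open>card X\<close> in their denominators, which must therefore be nonzero.\<close>
    moreover have "card X > 0"
      using fin \<open>y \<in> X\<close> by (auto simp: card_gt_0_iff)
    ultimately show ?thesis
      by (simp add: y_def[symmetric])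
  qed
  have "gpd_card C = (\<Sum>X\<in>obj C // R. \<Sum>x\<in>X. 1 / of_nat (card (star C x)))"
    unfolding gpd_card_def iso_classes_def R_def[symmetric]
    by (rule sum.cong[OF refl class_sum])
  also have "\<dots> = (\<Sum>x\<in>\<Union>(obj C // R). 1 / of_nat (card (star C x)))"
    using quotient_disj[OF R] finite_subset[OF in_quotient_imp_subset[OF R] finite_obj]
    by (subst sum.Union_disjoint) auto
  also have "\<Union>(obj C // R) = obj C"
    by (rule Union_quotient[OF R])
  finally show ?thesis .
qed

section \<open>Cardinalities of the basic constructions\<close>

lemma gpd_card_discrete_cat: "finite S \<Longrightarrow> gpd_card (discrete_cat S) = of_nat (card S)"
  by (simp add: finite_groupoid.gpd_card_eq_sum_star finite_groupoid_discrete_cat)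
    (simp add: discrete_cat_def star_def conj_commute cong: conj_cong)

lemma gpd_card_cyclic_cat: "0 < n \<Longrightarrow> gpd_card (cyclic_cat n) = 1 / of_nat n"
  by (simp add: finite_groupoid.gpd_card_eq_sum_star finite_groupoid_cyclic_cat)
    (simp add: cyclic_cat_def group_cat_def star_def carrier_integer_mod_group del: atLeastLessThan_iff)

text \<open>No arrow leaves its summand, so the stars are unchanged and the sum over objects splits
  in two.\<close>

lemma gpd_card_sum_cat:
  assumes "finite_groupoid C" "finite_groupoid D"
  shows "gpd_card (sum_cat C D) = gpd_card C + gpd_card D"
proof -
  have obj: "obj (sum_cat C D) = obj C <+> obj D"
    by (simp add: sum_cat_def)
  have star: "star (sum_cat C D) (Inl x) = Inl ` star C x" "star (sum_cat C D) (Inr y) = Inr ` star D y"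
    for x y by (auto simp: star_def sum_cat_def)
  show ?thesis
    using assms finite_groupoid.finite_obj[OF assms(1)] finite_groupoid.finite_obj[OF assms(2)]
    by (simp add: finite_groupoid.gpd_card_eq_sum_star finite_groupoid_sum_cat obj sum.Plus star card_image)
qed

lemma gpd_card_prod_cat:
  assumes "finite_groupoid C" "finite_groupoid D"
  shows "gpd_card (prod_cat C D) = gpd_card C * gpd_card D"
proof -
  have obj: "obj (prod_cat C D) = obj C \<times> obj D"
    by (simp add: prod_cat_def)
  have star: "star (prod_cat C D) p = star C (fst p) \<times> star D (snd p)" for p
    by (auto simp: star_def prod_cat_def)
  show ?thesis
    using assms
    by (simp add: finite_groupoid.gpd_card_eq_sum_star finite_groupoid_prod_cat obj star
        sum_product sum.cartesian_product card_cartesian_product case_prod_unfold)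
qed

text \<open>The star of a family is the product of the stars of its members, so each summand
  factors. By \<open>prod_sum_PiE\<close>, the sum over all families of objects is then a product of
  sums.\<close>

lemma gpd_card_Prod_cat:
  assumes "finite I" "\<And>i. i \<in> I \<Longrightarrow> finite_groupoid (C i)"
  shows "gpd_card (Prod_cat I C) = (\<Prod>i\<in>I. gpd_card (C i))"
proof -
  have obj: "obj (Prod_cat I C) = (\<Pi>\<^sub>E i\<in>I. obj (C i))"
    by (simp add: Prod_cat_def)
  have star: "star (Prod_cat I C) x = (\<Pi>\<^sub>E i\<in>I. star (C i) (x i))" if "x \<in> (\<Pi>\<^sub>E i\<in>I. obj (C i))" for x
    using that by (auto simp: star_def Prod_cat_def PiE_iff extensional_def restrict_def fun_eq_iff)
  show ?thesis
    using assms
    by (simp add: finite_groupoid.gpd_card_eq_sum_star finite_groupoid_Prod_cat obj star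
        card_PiE prod_sum_PiE finite_groupoid.finite_obj prod_dividef cong: prod.cong sum.cong)
qed

lemma finite_groupoid_pochhammer_cat:
  assumes "finite_groupoid G" "finite_groupoid K"
  shows "finite_groupoid (pochhammer_cat G K n)"
  unfolding pochhammer_cat_def using assms
  by (intro finite_groupoid_Prod_cat finite_groupoid_sum_cat finite_groupoid_prod_cat
      finite_groupoid_discrete_cat) auto

lemma gpd_card_pochhammer_cat:
  assumes "finite_groupoid G" "finite_groupoid K"
  shows "gpd_card (pochhammer_cat G K n) = (\<Prod>i = 0..<n. gpd_card G + gpd_card K * of_nat i)"
  using assms
  by (simp add: pochhammer_cat_def gpd_card_Prod_cat gpd_card_sum_cat gpd_card_prod_cat
      gpd_card_discrete_cat finite_groupoid_sum_cat finite_groupoid_prod_cat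
      finite_groupoid_discrete_cat)


section \<open>The generating series of the hypergeometric species\<close>

text \<open>\<open>integer_mod_group 0\<close> is the infinite group of integers. Positivity of
  \<open>b i\<close> and \<open>c j\<close> keeps all orders \<open>b i\<close> and
  \<open>c j + m * d j\<close> of the cyclic factors nonzero.\<close>

lemma finite_groupoid_H_gpd:
  assumes "\<And>i. i \<in> {1..k} \<Longrightarrow> 0 < b i" "\<And>j. j \<in> {1..l} \<Longrightarrow> 0 < c j" "finite x"
  shows "finite_groupoid (H_gpd k a b l c d x)"
  unfolding H_gpd_def using assms
  by (intro finite_groupoid_prod_cat finite_groupoid_Prod_cat finite_groupoid_pochhammer_cat
      finite_groupoid_discrete_cat finite_groupoid_cyclic_cat finite_PiE add_pos_nonneg) auto

text \<open>Pulling \<open>b\<close> out of each factor turns a progression of step \<open>b\<close>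
  into one of step 1. This is where the fractional parameters come from.\<close>

lemma prod_arithmetic_eq_pochhammer:
  fixes a b :: "'a::field"
  assumes "b \<noteq> 0"
  shows "(\<Prod>i = 0..<n. a + b * of_nat i) = b ^ n * pochhammer (a / b) n"
proof -
  have "(\<Prod>i = 0..<n. a + b * of_nat i) = (\<Prod>i = 0..<n. b * (a / b + of_nat i))"
    using assms by (intro prod.cong) (auto simp: field_simps)
  then show ?thesis
    by (simp add: prod.distrib pochhammer_prod)
qed

lemma gpd_card_H_gpd:
  assumes b: "\<And>i. i \<in> {1..k} \<Longrightarrow> 0 < b i"
    and c: "\<And>j. j \<in> {1..l} \<Longrightarrow> 0 < c j" and d: "\<And>j. j \<in> {1..l} \<Longrightarrow> 0 < d j" and "finite x"
  shows "gpd_card (H_gpd k a b l c d x) =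
    (\<Prod>i = 1..k. pochhammer (of_nat (a i) / of_nat (b i)) (card x)) /
    (\<Prod>j = 1..l. pochhammer (of_nat (c j) / of_nat (d j)) (card x))"
proof -
  let ?P = "\<lambda>i. pochhammer_cat (discrete_cat {1..a i}) (discrete_cat {1..b i}) (card x)"
  let ?B = "\<lambda>i. Prod_cat x (\<lambda>_. cyclic_cat (b i))"
  let ?D = "\<lambda>j. discrete_cat (x \<rightarrow>\<^sub>E {1..d j})"
  let ?Z = "\<lambda>j. Prod_cat {0..<card x} (\<lambda>i. cyclic_cat (c j + i * d j))"
  have fin: "finite_groupoid (?P i)" "finite_groupoid (?B i)" if "i \<in> {1..k}" for i
    using that b \<open>finite x\<close>
    by (auto intro!: finite_groupoid_pochhammer_cat finite_groupoid_discrete_cat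
        finite_groupoid_Prod_cat finite_groupoid_cyclic_cat)
  have fin': "finite_groupoid (?D j)" "finite_groupoid (?Z j)" if "j \<in> {1..l}" for j
    using that c \<open>finite x\<close>
    by (auto intro!: finite_groupoid_discrete_cat finite_PiE add_pos_nonneg
        finite_groupoid_Prod_cat finite_groupoid_cyclic_cat)
  \<comment> \<open>The power of \<open>b i\<close> split off from the progression is cancelled by
    the copies of the cyclic group of order \<open>b i\<close>, one for each element of
    \<open>x\<close>.\<close>
  have num: "gpd_card (prod_cat (?P i) (?B i)) = pochhammer (of_nat (a i) / of_nat (b i)) (card x)"
    if "i \<in> {1..k}" for i
    unfolding gpd_card_prod_cat[OF fin[OF that]] using b[OF that] \<open>finite x\<close>
    by (simp add: gpd_card_pochhammer_cat gpd_card_Prod_cat gpd_card_discrete_cat gpd_card_cyclic_cat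
        finite_groupoid_discrete_cat finite_groupoid_cyclic_cat prod_arithmetic_eq_pochhammer
        power_one_over)
  \<comment> \<open>Here the maps from \<open>x\<close> to \<open>{1..d j}\<close> supply the power
    of \<open>d j\<close> that cancels the one in the denominator.\<close>
  have den: "gpd_card (prod_cat (?D j) (?Z j)) =
      1 / pochhammer (of_nat (c j) / of_nat (d j)) (card x)" if "j \<in> {1..l}" for j
  proof -
    have "gpd_card (?Z j) = (\<Prod>i = 0..<card x. 1 / of_nat (c j + i * d j))"
      using c[OF that] by (simp add: gpd_card_Prod_cat gpd_card_cyclic_cat finite_groupoid_cyclic_cat)
    also have "\<dots> = 1 / (\<Prod>i = 0..<card x. of_nat (c j) + of_nat (d j) * of_nat i)"
      by (simp add: prod_dividef mult.commute)
    also have "\<dots> = 1 / (of_nat (d j) ^ card x * pochhammer (of_nat (c j) / of_nat (d j)) (card x))"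
      using d[OF that] by (simp add: prod_arithmetic_eq_pochhammer)
    finally show ?thesis
      unfolding gpd_card_prod_cat[OF fin'[OF that]]
      using d[OF that] \<open>finite x\<close> by (simp add: gpd_card_discrete_cat finite_PiE card_PiE)
  qed
  note fin_num = finite_groupoid_prod_cat[OF fin] and fin_den = finite_groupoid_prod_cat[OF fin']
  have "gpd_card (H_gpd k a b l c d x) =
      gpd_card (Prod_cat {1..k} (\<lambda>i. prod_cat (?P i) (?B i))) *
      gpd_card (Prod_cat {1..l} (\<lambda>j. prod_cat (?D j) (?Z j)))"
    unfolding H_gpd_def
    by (intro gpd_card_prod_cat finite_groupoid_Prod_cat fin_num fin_den) auto
  also have "\<dots> = (\<Prod>i = 1..k. pochhammer (of_nat (a i) / of_nat (b i)) (card x)) *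
      (\<Prod>j = 1..l. 1 / pochhammer (of_nat (c j) / of_nat (d j)) (card x))"
    by (intro arg_cong2[of _ _ _ _ "(*)"] trans[OF gpd_card_Prod_cat[OF _ fin_num] prod.cong[OF refl num]]
        trans[OF gpd_card_Prod_cat[OF _ fin_den] prod.cong[OF refl den]]) auto
  finally show ?thesis
    by (simp add: prod_dividef)
qed

text \<open>\<open>fps_hypergeo_nth\<close> gives coefficients as folds over the parameter lists;
  this turns them into indexed products.\<close>

lemma foldl_mult_eq_prod:
  fixes f :: "'b \<Rightarrow> 'a::comm_monoid_mult"
  shows "foldl (\<lambda>r x. r * f x) z (map g [1..<Suc k]) = z * (\<Prod>i = 1..k. f (g i))"
  by (induction k) (auto simp: mult.assoc)

lemma generating_series_H_species:
  assumes "\<And>i. i \<in> {1..k} \<Longrightarrow> 0 < b i"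
    and "\<And>j. j \<in> {1..l} \<Longrightarrow> 0 < c j" and "\<And>j. j \<in> {1..l} \<Longrightarrow> 0 < d j"
  shows "generating_series (H_species k a b l c d) =
      hypergeometric_series (map (\<lambda>i. of_nat (a i) / of_nat (b i)) [1..<Suc k])
                            (map (\<lambda>j. of_nat (c j) / of_nat (d j)) [1..<Suc l])"
proof (rule fps_ext)
  fix n
  have "gpd_card (H_gpd k a b l c d {1..n}) =
      (\<Prod>i = 1..k. pochhammer (of_nat (a i) / of_nat (b i)) n) /
      (\<Prod>j = 1..l. pochhammer (of_nat (c j) / of_nat (d j)) n)"
    by (subst gpd_card_H_gpd) (use assms in auto)
  then show "fps_nth (generating_series (H_species k a b l c d)) n =
      fps_nth (hypergeometric_series (map (\<lambda>i. of_nat (a i) / of_nat (b i)) [1..<Suc k])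
                                     (map (\<lambda>j. of_nat (c j) / of_nat (d j)) [1..<Suc l])) n"
    unfolding generating_series_def hypergeometric_series_def fps_hypergeo_nth foldl_mult_eq_prod
    by (simp add: H_species_def)
qed


section \<open>Functors\<close>

lemma cat_functor_identity:
  assumes "category C"
  shows "cat_functor C C \<lparr>fobj = id, farr = id\<rparr>"
  using assms by (simp add: cat_functor_def cat_functor_axioms_def)

text \<open>The functor laws only evaluate \<open>F\<close> on objects and arrows of
  \<open>C\<close>. Restriction gives the extensional maps that arrows of \<open>gpd\<close>
  require.\<close>

lemma cat_functor_restrict:
  assumes "cat_functor C D F"
  shows "cat_functor C D \<lparr>fobj = restrict (fobj F) (obj C), farr = restrict (farr F) (arr C)\<rparr>"
proof -
  interpret cat_functor C D F by fact
  have hom_arr: "f \<in> homset C x y \<Longrightarrow> f \<in> arr C" for f x y by (auto simp: homset_def)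
  show ?thesis
    by unfold_locales (auto simp: fobj_in_obj farr_idn farr_cmp S.homset_objD
        hom_arr hom_arr[OF S.idn_in_hom] hom_arr[OF S.cmp_in_hom] intro: farr_in_hom)
qed

lemma cat_functor_compose:
  assumes "cat_functor C D F" "cat_functor D E G"
  shows "cat_functor C E
    \<lparr>fobj = compose (obj C) (fobj G) (fobj F), farr = compose (arr C) (farr G) (farr F)\<rparr>"
proof -
  interpret F: cat_functor C D F by fact
  interpret G: cat_functor D E G by fact
  \<comment> \<open>The laws are checked for the unrestricted composite; its restriction is exactly
    the \<open>compose\<close> form.\<close>
  have "cat_functor C E \<lparr>fobj = fobj G \<circ> fobj F, farr = farr G \<circ> farr F\<rparr>"
    by unfold_locales (auto simp: F.fobj_in_obj G.fobj_in_obj F.farr_idn G.farr_idn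
        F.farr_cmp G.farr_cmp[OF F.farr_in_hom F.farr_in_hom] intro: F.farr_in_hom G.farr_in_hom)
  from cat_functor_restrict[OF this] show ?thesis
    by (simp add: compose_def comp_def)
qed

lemma cat_functor_prod_cat:
  assumes "cat_functor C D \<lparr>fobj = f, farr = g\<rparr>" "cat_functor C' D' \<lparr>fobj = f', farr = g'\<rparr>"
  shows "cat_functor (prod_cat C C') (prod_cat D D')
    \<lparr>fobj = map_prod f f', farr = map_prod g g'\<rparr>"
proof -
  interpret F: cat_functor C D "\<lparr>fobj = f, farr = g\<rparr>" by fact
  interpret F': cat_functor C' D' "\<lparr>fobj = f', farr = g'\<rparr>" by fact
  interpret S: category "prod_cat C C'" by (intro category_prod_cat F.S.category_axioms F'.S.category_axioms)
  interpret T: category "prod_cat D D'" by (intro category_prod_cat F.T.category_axioms F'.T.category_axioms)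
  note F = F.fobj_in_obj F'.fobj_in_obj F.farr_idn F'.farr_idn F.farr_cmp F'.farr_cmp
    F.farr_in_hom F'.farr_in_hom
  show ?thesis
    by (unfold_locales, unfold homset_prod_cat) (auto simp: prod_cat_def F[simplified])
qed

lemma cat_functor_Prod_cat:
  assumes "\<And>i. i \<in> I \<Longrightarrow> cat_functor (C i) (D i) \<lparr>fobj = f i, farr = g i\<rparr>"
  shows "cat_functor (Prod_cat I C) (Prod_cat I D)
    \<lparr>fobj = \<lambda>u. \<lambda>i\<in>I. f i (u i), farr = \<lambda>u. \<lambda>i\<in>I. g i (u i)\<rparr>"
proof -
  have C: "category (C i)" and D: "category (D i)" if "i \<in> I" for i
    using assms[OF that] by (auto simp: cat_functor_def)
  interpret S: category "Prod_cat I C" by (rule category_Prod_cat[OF C])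
  interpret T: category "Prod_cat I D" by (rule category_Prod_cat[OF D])
  show ?thesis
    by (unfold_locales, unfold homset_Prod_cat)
      (auto simp: Prod_cat_def PiE_iff fun_eq_iff
        cat_functor.fobj_in_obj[OF assms, simplified] cat_functor.farr_idn[OF assms, simplified]
        intro: cat_functor.farr_in_hom[OF assms, simplified] cat_functor.farr_cmp[OF assms, simplified])
qed

section \<open>Relabelling along a bijection\<close>

lemma relabel_in_PiE:
  assumes "bij_betw f x y" "p \<in> x \<rightarrow>\<^sub>E A"
  shows "relabel x f y p \<in> y \<rightarrow>\<^sub>E A"
  using assms bij_betwE[OF bij_betw_inv_into[OF assms(1)]] by (auto simp: relabel_def)

lemma relabel_identity: "p \<in> extensional x \<Longrightarrow> relabel x (\<lambda>a\<in>x. a) x p = p"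
  by (auto simp: relabel_def extensional_def fun_eq_iff inv_into_def)
    (metis (mono_tags, lifting) someI_ex)

text \<open>Relabelling reads coordinates through the inverse bijection, and inverting a composite
  reverses the order. Outside \<open>z\<close> both sides are \<open>undefined\<close>.\<close>

lemma relabel_compose:
  assumes "bij_betw f x y" "bij_betw g y z"
  shows "relabel y g z (relabel x f y p) = relabel x (compose x g f) z p"
proof
  fix t
  have inv: "inv_into x (compose x g f) t = inv_into x f (inv_into y g t)" if "t \<in> z"
  proof -
    have t: "inv_into y g t \<in> y" "inv_into x f (inv_into y g t) \<in> x"
      using assms that by (meson bij_betwE bij_betw_inv_into)+
    \<comment> \<open>The composite sends the claimed preimage to \<open>t\<close>, and injectivity
      identifies it with \<open>inv_into\<close>.\<close>
    moreover have "inj_on (compose x g f) x"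
      using bij_betw_compose[OF assms] by (simp add: bij_betw_def)
    moreover have "compose x g f (inv_into x f (inv_into y g t)) = t"
      using assms that t by (simp add: compose_eq bij_betw_inv_into_right)
    ultimately show ?thesis
      by (metis inv_into_f_f)
  qed
  have "inv_into y g t \<in> y" if "t \<in> z"
    using assms(2) that by (meson bij_betwE bij_betw_inv_into)
  then show "relabel y g z (relabel x f y p) t = relabel x (compose x g f) z p t"
    by (auto simp: relabel_def inv)
qed

text \<open>All factors are the same \<open>C\<close>, so each functor law at coordinate
  \<open>t\<close> of the target is the law at coordinate \<open>inv_into x f t\<close> of the
  source.\<close>

lemma cat_functor_relabel_Prod_cat:
  assumes "bij_betw f x y" "category C"
  shows "cat_functor (Prod_cat x (\<lambda>_. C)) (Prod_cat y (\<lambda>_. C))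
    \<lparr>fobj = relabel x f y, farr = relabel x f y\<rparr>"
proof -
  have inv: "inv_into x f t \<in> x" if "t \<in> y" for t
    using assms(1) that by (meson bij_betwE bij_betw_inv_into)
  interpret S: category "Prod_cat x (\<lambda>_. C)" by (rule category_Prod_cat) (rule assms(2))
  interpret T: category "Prod_cat y (\<lambda>_. C)" by (rule category_Prod_cat) (rule assms(2))
  show ?thesis
    by (unfold_locales, unfold homset_Prod_cat)
      (auto simp: Prod_cat_def PiE_iff relabel_def inv fun_eq_iff)
qed

lemma cat_functor_discrete_cat:
  assumes "\<And>s. s \<in> S \<Longrightarrow> f s \<in> T"
  shows "cat_functor (discrete_cat S) (discrete_cat T) \<lparr>fobj = f, farr = f\<rparr>"
proof -
  interpret S: groupoid "discrete_cat S" by (rule groupoid_discrete_cat)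
  interpret T: groupoid "discrete_cat T" by (rule groupoid_discrete_cat)
  show ?thesis
    by unfold_locales (use assms in \<open>auto simp: discrete_cat_def homset_def\<close>)
qed


section \<open>The hypergeometric species is a functor\<close>

text \<open>The identity laws hold as equalities because arrows carry extensional maps: composing
  with a restricted identity only restricts the map to its own domain.\<close>

lemma category_finbij: "category finbij"
proof -
  have hom: "(x', f, y') \<in> homset finbij x y \<longleftrightarrow> x' = x \<and> y' = y \<and> finite x \<and> finite y \<and>
      f \<in> extensional x \<and> bij_betw f x y" for x x' y y' and f :: "'a \<Rightarrow> 'a"
    by (auto simp: homset_def finbij_def)
  have idn: "idn finbij x = (x, \<lambda>a\<in>x. a, x)" for x :: "'a set"
    by (simp add: finbij_def)
  have cmp: "cmp finbij (y, g, z) (x, f, y') = (x, compose x g f, z)" for x y y' z and g f :: "'a \<Rightarrow> 'a"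
    by (simp add: finbij_def)
  have bij_id: "bij_betw (\<lambda>a. a) x x" for x :: "'a set"
    by (simp add: bij_betw_def)
  show ?thesis
  proof
    fix f :: "'a set \<times> ('a \<Rightarrow> 'a) \<times> 'a set"
    assume "f \<in> arr finbij"
    then show "src finbij f \<in> obj finbij" "trg finbij f \<in> obj finbij"
      by (auto simp: finbij_def)
  next
    fix x :: "'a set" assume "x \<in> obj finbij"
    then show "idn finbij x \<in> homset finbij x x"
      by (simp add: idn hom bij_id) (simp add: finbij_def)
  qed (auto simp: hom idn cmp fun_eq_iff compose_def extensional_def
      intro: bij_betw_trans[unfolded comp_def] dest: bij_betw_apply)
qed

lemma category_gpd: "category gpd"
proof -
  have hom: "(G', F, K') \<in> homset gpd G K \<longleftrightarrow> G' = G \<and> K' = K \<and> finite_groupoid G \<and>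
      finite_groupoid K \<and> cat_functor G K F \<and> fobj F \<in> extensional (obj G) \<and> farr F \<in> extensional (arr G)"
    for G G' K K' :: "('a, 'b) cat" and F
    by (auto simp: homset_def gpd_def)
  have idn: "idn gpd G = (G, \<lparr>fobj = \<lambda>x\<in>obj G. x, farr = \<lambda>f\<in>arr G. f\<rparr>, G)" for G :: "('a, 'b) cat"
    by (simp add: gpd_def)
  have cmp: "cmp gpd (K, E, L) (G, F, K') = (G, \<lparr>fobj = compose (obj G) (fobj E) (fobj F),
      farr = compose (arr G) (farr E) (farr F)\<rparr>, L)" for K K' L G :: "('a, 'b) cat" and E F
    by (simp add: gpd_def)
  \<comment> \<open>Values of a functor stay where the restricted maps of the next arrow are
    defined; the left identity law and associativity rest on this.\<close>
  have arr: "farr F f \<in> arr D" if "cat_functor C D F" "f \<in> arr C" for C D :: "('a, 'b) cat" and F f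
    using cat_functor.farr_in_hom[OF that(1), of f] that(2) by (auto simp: homset_def)
  have obj: "fobj F x \<in> obj D" if "cat_functor C D F" "x \<in> obj C" for C D :: "('a, 'b) cat" and F x
    using cat_functor.fobj_in_obj[OF that] .
  show ?thesis
  proof
    fix f :: "('a, 'b) gpd_arr"
    assume "f \<in> arr gpd"
    then show "src gpd f \<in> obj gpd" "trg gpd f \<in> obj gpd"
      by (auto simp: gpd_def)
  next
    fix G :: "('a, 'b) cat" assume "G \<in> obj gpd"
    then have G: "finite_groupoid G" by (simp add: gpd_def)
    then have "category G" by (simp add: finite_groupoid_def groupoid_def)
    from cat_functor_restrict[OF cat_functor_identity[OF this]] G
    show "idn gpd G \<in> homset gpd G G"
      by (simp add: idn hom id_def)
  qed (auto simp: hom idn cmp cat_functor_compose[unfolded compose_def] fun_eq_iff compose_def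
      extensional_def arr obj intro!: functr.equality)
qed

lemma category_cyclic_cat: "category (cyclic_cat n)"
  unfolding cyclic_cat_def by (intro groupoid.axioms(1) groupoid_group_cat) simp

lemma category_discrete_cat: "category (discrete_cat S)"
  by (rule groupoid.axioms(1)[OF groupoid_discrete_cat])

lemma category_pochhammer_cat:
  assumes "category G" "category K"
  shows "category (pochhammer_cat G K n)"
  unfolding pochhammer_cat_def using assms
  by (intro category_Prod_cat category_sum_cat category_prod_cat category_discrete_cat)

lemma cat_functor_H_relabel:
  assumes "bij_betw f x y"
  shows "cat_functor (H_gpd k a b l c d x) (H_gpd k a b l c d y)
    \<lparr>fobj = H_relabel k l x f y, farr = H_relabel k l x f y\<rparr>"
proof -
  \<comment> \<open>The factors depending only on the size of the set coincide for \<open>x\<close>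
    and \<open>y\<close>, so the identity functor can act on them.\<close>
  have card: "card y = card x"
    using assms by (simp add: bij_betw_same_card)
  have "cat_functor
      (prod_cat (pochhammer_cat (discrete_cat {1..a i}) (discrete_cat {1..b i}) (card x))
                (Prod_cat x (\<lambda>_. cyclic_cat (b i))))
      (prod_cat (pochhammer_cat (discrete_cat {1..a i}) (discrete_cat {1..b i}) (card y))
                (Prod_cat y (\<lambda>_. cyclic_cat (b i))))
      \<lparr>fobj = map_prod id (relabel x f y), farr = map_prod id (relabel x f y)\<rparr>" for i
    unfolding card
    by (intro cat_functor_prod_cat cat_functor_identity cat_functor_relabel_Prod_cat assms
        category_pochhammer_cat category_discrete_cat category_cyclic_cat)
  note num = cat_functor_Prod_cat[of "{1..k}", OF this]
  have "cat_functor
      (prod_cat (discrete_cat (x \<rightarrow>\<^sub>E {1..d j})) (Prod_cat {0..<card x} (\<lambda>i. cyclic_cat (c j + i * d j))))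
      (prod_cat (discrete_cat (y \<rightarrow>\<^sub>E {1..d j})) (Prod_cat {0..<card y} (\<lambda>i. cyclic_cat (c j + i * d j))))
      \<lparr>fobj = map_prod (relabel x f y) id, farr = map_prod (relabel x f y) id\<rparr>" for j
    unfolding card
    by (intro cat_functor_prod_cat cat_functor_identity cat_functor_discrete_cat relabel_in_PiE assms
        category_Prod_cat category_cyclic_cat)
  note den = cat_functor_Prod_cat[of "{1..l}", OF this]
  show ?thesis
    using cat_functor_prod_cat[OF num den]
    by (simp add: H_gpd_def H_relabel_def map_prod_def)
qed

text \<open>Only extensionality of the outer families and of the relabelled components enters, so
  one polymorphic statement covers both objects and arrows of \<open>H_gpd\<close>.\<close>

lemma H_relabel_identity:
  assumes "u \<in> extensional {1..k}" "\<And>i. i \<in> {1..k} \<Longrightarrow> snd (u i) \<in> extensional x"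
    and "v \<in> extensional {1..l}" "\<And>j. j \<in> {1..l} \<Longrightarrow> fst (v j) \<in> extensional x"
  shows "H_relabel k l x (\<lambda>a\<in>x. a) x (u, v) = (u, v)"
proof -
  have "map_prod id (relabel x (\<lambda>a\<in>x. a) x) (u i) = u i" if "i \<in> {1..k}" for i
    using assms(2)[OF that] by (cases "u i") (simp add: relabel_identity)
  moreover have "map_prod (relabel x (\<lambda>a\<in>x. a) x) id (v j) = v j" if "j \<in> {1..l}" for j
    using assms(4)[OF that] by (cases "v j") (simp add: relabel_identity)
  ultimately show ?thesis
    using assms(1,3) by (auto simp: H_relabel_def fun_eq_iff extensional_def)
qed

lemma H_relabel_compose:
  assumes "bij_betw f x y" "bij_betw g y z"
  shows "H_relabel k l y g z (H_relabel k l x f y w) = H_relabel k l x (compose x g f) z w"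
  by (cases w) (auto simp: H_relabel_def relabel_compose[OF assms] map_prod_def split: prod.splits
      intro!: restrict_ext)

lemma species_H_species:
  fixes k l :: nat and a b c d :: "nat \<Rightarrow> nat"
  assumes "\<And>i. i \<in> {1..k} \<Longrightarrow> 0 < b i" "\<And>j. j \<in> {1..l} \<Longrightarrow> 0 < c j"
  shows "species (H_species k a b l c d :: ('x, 'x H_obj, 'x H_arr) species)"
proof -
  let ?H = "H_gpd k a b l c d :: 'x set \<Rightarrow> ('x H_obj, 'x H_arr) cat"
  have fin: "finite_groupoid (?H x)" if "finite x" for x
    by (rule finite_groupoid_H_gpd[OF assms that])
  interpret S: category "finbij :: ('x set, 'x set \<times> ('x \<Rightarrow> 'x) \<times> 'x set) cat"
    by (rule category_finbij)
  interpret T: category "gpd :: (('x H_obj, 'x H_arr) cat, ('x H_obj, 'x H_arr) gpd_arr) cat"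
    by (rule category_gpd)
  have hom: "h \<in> homset finbij x y \<longleftrightarrow> (\<exists>f. h = (x, f, y) \<and> finite x \<and> finite y \<and>
      f \<in> extensional x \<and> bij_betw f x y)" for h :: "'x set \<times> ('x \<Rightarrow> 'x) \<times> 'x set" and x y
    by (auto simp: homset_def finbij_def)
  show ?thesis
  proof
    fix x :: "'x set" assume "x \<in> obj finbij"
    then have "finite x" by (simp add: finbij_def)
    then show "fobj (H_species k a b l c d) x \<in> obj gpd"
      by (simp add: H_species_def gpd_def fin)
    have "H_relabel k l x (\<lambda>a\<in>x. a) x w = w" if "w \<in> obj (?H x)" for w
      using that by (cases w) (auto simp: H_gpd_def prod_cat_def Prod_cat_def discrete_cat_def
          PiE_iff mem_Times_iff intro!: H_relabel_identity)
    moreover have "H_relabel k l x (\<lambda>a\<in>x. a) x w = w" if "w \<in> arr (?H x)" for w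
      using that by (cases w) (auto simp: H_gpd_def prod_cat_def Prod_cat_def discrete_cat_def
          PiE_iff mem_Times_iff intro!: H_relabel_identity)
    ultimately show "farr (H_species k a b l c d) (idn finbij x) =
        idn gpd (fobj (H_species k a b l c d) x :: ('x H_obj, 'x H_arr) cat)"
      by (simp add: H_species_def finbij_def gpd_def cong: restrict_cong)
  next
    fix h :: "'x set \<times> ('x \<Rightarrow> 'x) \<times> 'x set" and x y
    assume "h \<in> homset finbij x y"
    then obtain f where h: "h = (x, f, y)" "finite x" "finite y" "bij_betw f x y"
      by (auto simp: hom)
    \<comment> \<open>\<open>H_species\<close> restricts \<open>H_relabel\<close> to the objects and
      arrows, which gives the extensionality demanded of arrows of \<open>gpd\<close>.\<close>
    from cat_functor_restrict[OF cat_functor_H_relabel[OF h(4)]]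
    show "farr (H_species k a b l c d) h \<in> homset gpd (fobj (H_species k a b l c d) x)
        (fobj (H_species k a b l c d) y :: ('x H_obj, 'x H_arr) cat)"
      using h by (simp add: H_species_def gpd_def homset_def fin)
  next
    fix h h' :: "'x set \<times> ('x \<Rightarrow> 'x) \<times> 'x set" and x y z
    assume "h \<in> homset finbij x y" "h' \<in> homset finbij y z"
    then obtain f g where f: "h = (x, f, y)" "bij_betw f x y" and g: "h' = (y, g, z)" "bij_betw g y z"
      by (auto simp: hom)
    interpret F: cat_functor "?H x" "?H y" "\<lparr>fobj = H_relabel k l x f y, farr = H_relabel k l x f y\<rparr>"
      by (rule cat_functor_H_relabel[OF f(2)])
    \<comment> \<open>The second map in the composite is restricted to the groupoid at
      \<open>y\<close>. The first must land there, or the composite would take the default value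
      \<open>undefined\<close>.\<close>
    have "H_relabel k l x f y w \<in> obj (?H y)" if "w \<in> obj (?H x)" for w
      using F.fobj_in_obj[OF that] by simp
    moreover have "H_relabel k l x f y w \<in> arr (?H y)" if "w \<in> arr (?H x)" for w
      using F.farr_in_hom[of w] that by (simp add: homset_def)
    ultimately show "farr (H_species k a b l c d) (cmp finbij h' h) =
        cmp gpd (farr (H_species k a b l c d) h' :: ('x H_obj, 'x H_arr) gpd_arr)
          (farr (H_species k a b l c d) h)"
      by (simp add: f(1) g(1) H_species_def finbij_def gpd_def compose_def
          H_relabel_compose[OF f(2) g(2), unfolded compose_def] cong: restrict_cong)
  qed
qed

theorem theorem16:
  fixes k l :: nat and a b c d :: "nat \<Rightarrow> nat"
  assumes "\<And>i. i \<in> {1..k} \<Longrightarrow> 0 < a i" and "\<And>i. i \<in> {1..k} \<Longrightarrow> 0 < b i"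
    and "\<And>j. j \<in> {1..l} \<Longrightarrow> 0 < c j" and "\<And>j. j \<in> {1..l} \<Longrightarrow> 0 < d j"
  shows "species (H_species k a b l c d :: ('x, 'x H_obj, 'x H_arr) species) \<and>
    generating_series (H_species k a b l c d) =
      hypergeometric_series (map (\<lambda>i. of_nat (a i) / of_nat (b i)) [1..<Suc k])
                            (map (\<lambda>j. of_nat (c j) / of_nat (d j)) [1..<Suc l])"
  using assms species_H_species generating_series_H_species by blast

end
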